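(* Let $D=\{1,\dots,d\}$, let $\mathbf X=(X_1,\dots,X_d)$ be continuous explanatory variables and $Y$ a discrete target variable (index $0$). Consider an intermediate structure constructed from the ordered sequence of clusters given by the GNB structure learning algorithm described in the context, i.e. the structure formed by the first several clusters $(0,i,j)$ of the sequence, and let $D'\subset D$ be the set of indices of the explanatory variables occurring in these clusters. Then this structure is a GNB forest, and the probability distribution assigned to it is $$p(Y,\mathbf X_{D'})=\prod_{T_k\in\mathcal T}\frac{\prod_{(0,i,j)\in\mathcal C_{T_k}}p(Y,X_i,X_j)}{\prod_{(0,s)\in\mathcal S_{T_k}}p(Y,X_s)^{\nu_s-1}}\cdot\frac{1}{p(Y)^{|\mathcal T|-1}},$$ where $\mathcal T=\mathcal T_{D'}$ is the forest (set of disjoint trees) constructed by Kruskal's algorithm on the intermediate set of vertices $D'$, and, for $T_k\in\mathcal T$, $\mathcal C_{T_k}$ and $\mathcal S_{T_k}$ are the sets of clusters and separators of the sub-GNB structure corresponding to $T_k$, and $\nu_s$ is the multiplicity of the separator $(0,s)$.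
   Context: Structure learning algorithm: assign to each pair $l\neq m$ in $D$ one of the following weights, depending on the chosen method. Gaussian: $\sum_{y}p(y)\log(1-\rho^2_{lm\mid y})$, with $\rho_{lm\mid y}$ the correlation of $X_l,X_m$ within class $Y=y$. Gauss copula: $\sum_{y}p(y)\log(1-\rho^2_{G,lm\mid y})$, with $\rho_{G,lm\mid y}$ the parameter of the pair-Gauss copula of $X_l,X_m$ within class $Y=y$. General: $\sum_y p(y)I_{lm\mid y}$, with $I_{lm\mid y}$ the information content (sum of the entropies of the components minus the joint entropy) of the pair copula of $X_l,X_m$ within class $Y=y$. Then apply Kruskal's algorithm to find the maximum spanning tree of the weighted complete graph on $D$. The output is the set of clusters $(l,m,0)$, ordered by the order in which the edges $(l,m)$ are selected. GNB forest on $D'\subset D$: a structure in which all indices in $D'$ are linked to $0$ (which stands for $Y$) and a forest is defined on the set of indices in $D'$. Sub-GNB structure of a tree $T_k$: its clusters $\mathcal C_{T_k}$ are the triples $(0,i,j)$ with $(i,j)$ an edge of $T_k$; its separators $\mathcal S_{T_k}$ are the pairs $(0,s)$ that are intersections of connected clusters (clusters sharing two elements, those containing a common pair being connected tree-like); the multiplicity $\nu_s$ of $(0,s)$ is the number of these clusters containing it. Probability distribution assigned to a structure: the product of the marginal distributions over the clusters, divided by the product of the marginal distributions over the separators connecting clusters in a junction tree, a separator joining $\nu$ clusters being counted $\nu-1$ times. Here $p(Y,X_i,X_j)$, $p(Y,X_s)$, $p(Y)$ on the right-hand side are marginals of the joint density/mass function of $(\mathbf X,Y)$, while $p(Y,\mathbf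 X_{D'})$ on the left denotes the distribution assigned to the structure. *)

theory Defs
  imports "HOL-Probability.Probability"
begin

section \<open>Finite simple graphs\<close>

text \<open>
  A graph is a vertex set \<open>V\<close> together with a set \<open>E\<close> of two-element subsets of \<open>V\<close>. (In the
  symmetric digraphs of the AFP entry Graph Theory a closed walk \<open>a, b, a\<close> is a cycle, so the
  notions of forest and tree defined there do not describe undirected forests and trees.)
\<close>

definition simple_graph :: "'v set \<Rightarrow> 'v set set \<Rightarrow> bool" where
  "simple_graph V E \<longleftrightarrow> finite V \<and> (\<forall>e\<in>E. \<exists>u\<in>V. \<exists>v\<in>V. u \<noteq> v \<and> e = {u, v})"

definition simple_path :: "'v set \<Rightarrow> 'v set set \<Rightarrow> 'v list \<Rightarrow> bool" where
  "simple_path V E p \<longleftrightarrow> p \<noteq> [] \<and> set p \<subseteq> V \<and> distinct p \<and> successively (\<lambda>u v. {u, v} \<in> E) p"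

definition joined :: "'v set \<Rightarrow> 'v set set \<Rightarrow> 'v \<Rightarrow> 'v \<Rightarrow> bool" where
  "joined V E u v \<longleftrightarrow> (\<exists>p. simple_path V E p \<and> hd p = u \<and> last p = v)"

definition cycle :: "'v set set \<Rightarrow> 'v list \<Rightarrow> bool" where
  "cycle E p \<longleftrightarrow> length p \<ge> 3 \<and> distinct p \<and> successively (\<lambda>u v. {u, v} \<in> E) p \<and> {last p, hd p} \<in> E"

definition forest :: "'v set \<Rightarrow> 'v set set \<Rightarrow> bool" where
  "forest V E \<longleftrightarrow> simple_graph V E \<and> \<not> (\<exists>p. cycle E p)"

definition tree :: "'v set \<Rightarrow> 'v set set \<Rightarrow> bool" where
  "tree V E \<longleftrightarrow> forest V E \<and> V \<noteq> {} \<and> (\<forall>u\<in>V. \<forall>v\<in>V. joined V E u v)"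

text \<open>The connected components, each with its vertex set and its edge set.\<close>

definition tree_components :: "'v set \<Rightarrow> 'v set set \<Rightarrow> ('v set \<times> 'v set set) set" where
  "tree_components V E = (\<lambda>v. let W = {u \<in> V. joined V E v u} in (W, {e \<in> E. e \<subseteq> W})) ` V"

definition complete_edges :: "'v set \<Rightarrow> 'v set set" where
  "complete_edges V = {{u, v} | u v. u \<in> V \<and> v \<in> V \<and> u \<noteq> v}"

section \<open>Kruskal's algorithm\<close>

text \<open>
  \<open>kruskal_scan F es\<close> runs through the list \<open>es\<close>, appending to the list \<open>F\<close> of selected edges
  every edge that closes no cycle with the edges already selected.
\<close>

fun kruskal_scan :: "'v set list \<Rightarrow> 'v set list \<Rightarrow> 'v set list" where
  "kruskal_scan F [] = F"
| "kruskal_scan F (e # es) =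
     kruskal_scan (if \<exists>p. cycle (insert e (set F)) p then F else F @ [e]) es"

text \<open>
  \<open>kruskal V w F\<close>: the list \<open>F\<close> is, in order of selection, a possible output of Kruskal's algorithm
  for a maximum spanning tree of the complete graph on \<open>V\<close> with edge weights \<open>w\<close>. Edges of
  equal weight may be examined in any order.
\<close>

definition kruskal :: "'v set \<Rightarrow> ('v set \<Rightarrow> real) \<Rightarrow> 'v set list \<Rightarrow> bool" where
  "kruskal V w F \<longleftrightarrow>
     (\<exists>es. distinct es \<and> set es = complete_edges V \<and> sorted_wrt (\<lambda>e e'. w e \<ge> w e') es \<and>
           F = kruskal_scan [] es)"

section \<open>Edge weights\<close>

definition correlation :: "'w measure \<Rightarrow> ('w \<Rightarrow> real) \<Rightarrow> ('w \<Rightarrow> real) \<Rightarrow> real" where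
  "correlation N U V =
     (\<integral>\<omega>. (U \<omega> - (\<integral>\<omega>'. U \<omega>' \<partial>N)) * (V \<omega> - (\<integral>\<omega>'. V \<omega>' \<partial>N)) \<partial>N) /
     (sqrt (\<integral>\<omega>. (U \<omega> - (\<integral>\<omega>'. U \<omega>' \<partial>N))\<^sup>2 \<partial>N) * sqrt (\<integral>\<omega>. (V \<omega> - (\<integral>\<omega>'. V \<omega>' \<partial>N))\<^sup>2 \<partial>N))"

text \<open>
  The copula of two continuous random variables, given as the law on the unit square of which the
  copula function is the distribution function: by Sklar's theorem, the joint law of the
  probability integral transforms of the two variables.
\<close>

definition pair_copula :: "'w measure \<Rightarrow> ('w \<Rightarrow> real) \<Rightarrow> ('w \<Rightarrow> real) \<Rightarrow> (real \<times> real) measure" where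
  "pair_copula N U V =
     distr N (borel \<Otimes>\<^sub>M borel) (\<lambda>\<omega>. (cdf (distr N borel U) (U \<omega>), cdf (distr N borel V) (V \<omega>)))"

text \<open>The bivariate normal law with standard normal components and correlation \<open>r\<close>.\<close>

definition bivariate_normal :: "real \<Rightarrow> (real \<times> real) measure" where
  "bivariate_normal r = density (lborel \<Otimes>\<^sub>M lborel)
     (\<lambda>(a, b). ennreal (exp (- (a\<^sup>2 - 2 * r * a * b + b\<^sup>2) / (2 * (1 - r\<^sup>2))) / (2 * pi * sqrt (1 - r\<^sup>2))))"

definition gauss_copula :: "real \<Rightarrow> (real \<times> real) measure" where
  "gauss_copula r = pair_copula (bivariate_normal r) fst snd"

definition gauss_copula_parameter :: "'w measure \<Rightarrow> ('w \<Rightarrow> real) \<Rightarrow> ('w \<Rightarrow> real) \<Rightarrow> real" where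
  "gauss_copula_parameter N U V = (THE r. - 1 < r \<and> r < 1 \<and> pair_copula N U V = gauss_copula r)"

text \<open>Entropies are differential entropies, in natural units.\<close>

definition information_content :: "(real \<times> real) measure \<Rightarrow> real" where
  "information_content C =
     prob_space.entropy C (exp 1) lborel fst + prob_space.entropy C (exp 1) lborel snd
     - prob_space.entropy C (exp 1) (lborel \<Otimes>\<^sub>M lborel) (\<lambda>z. z)"

datatype weighting = Gaussian | Gauss_Copula | General

definition class_prob :: "'w measure \<Rightarrow> ('w \<Rightarrow> 'y) \<Rightarrow> 'y \<Rightarrow> real" where
  "class_prob M Y y = measure M {\<omega> \<in> space M. Y \<omega> = y}"

definition within_class :: "'w measure \<Rightarrow> ('w \<Rightarrow> 'y) \<Rightarrow> 'y \<Rightarrow> 'w measure" where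
  "within_class M Y y = uniform_measure M {\<omega> \<in> space M. Y \<omega> = y}"

text \<open>
  Conditioning on a class of probability zero gives the zero measure; such classes do not contribute
  to the weights, because of the factor \<open>class_prob M Y y\<close>.
\<close>

fun pair_weight ::
  "weighting \<Rightarrow> 'w measure \<Rightarrow> 'y set \<Rightarrow> (nat \<Rightarrow> 'w \<Rightarrow> real) \<Rightarrow> ('w \<Rightarrow> 'y) \<Rightarrow> nat \<Rightarrow> nat \<Rightarrow> real" where
  "pair_weight Gaussian M K X Y l m =
     (\<Sum>\<^sub>\<infinity>y\<in>K. class_prob M Y y * ln (1 - (correlation (within_class M Y y) (X l) (X m))\<^sup>2))"
| "pair_weight Gauss_Copula M K X Y l m =
     (\<Sum>\<^sub>\<infinity>y\<in>K. class_prob M Y y * ln (1 - (gauss_copula_parameter (within_class M Y y) (X l) (X m))\<^sup>2))"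
| "pair_weight General M K X Y l m =
     (\<Sum>\<^sub>\<infinity>y\<in>K. class_prob M Y y * information_content (pair_copula (within_class M Y y) (X l) (X m)))"

text \<open>
  The weights are symmetric in the two indices; \<open>Min e\<close> and \<open>Max e\<close> only serve to name the two ends
  of an edge \<open>e\<close>.
\<close>

definition edge_weight ::
  "weighting \<Rightarrow> 'w measure \<Rightarrow> 'y set \<Rightarrow> (nat \<Rightarrow> 'w \<Rightarrow> real) \<Rightarrow> ('w \<Rightarrow> 'y) \<Rightarrow> nat set \<Rightarrow> real" where
  "edge_weight a M K X Y e = pair_weight a M K X Y (Min e) (Max e)"

section \<open>Structures\<close>

text \<open>
  A structure on a set of indices is given by its set of clusters; two indices are linked if they
  occur in a common cluster. Index \<open>0\<close> stands for the target variable.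
\<close>

definition linked :: "nat set set \<Rightarrow> nat \<Rightarrow> nat \<Rightarrow> bool" where
  "linked C i j \<longleftrightarrow> i \<noteq> j \<and> (\<exists>c\<in>C. i \<in> c \<and> j \<in> c)"

definition gnb_forest :: "nat set \<Rightarrow> nat set \<Rightarrow> nat set set \<Rightarrow> bool" where
  "gnb_forest D D' C \<longleftrightarrow>
     D' \<subseteq> D \<and> 0 \<notin> D' \<and> (\<forall>c\<in>C. c \<subseteq> insert 0 D') \<and> (\<forall>i\<in>D'. linked C 0 i) \<and>
     forest D' {{i, j} | i j. i \<in> D' \<and> j \<in> D' \<and> linked C i j}"

definition gnb_clusters :: "nat set set \<Rightarrow> nat set set" where
  "gnb_clusters E = insert 0 ` E"

definition gnb_separators :: "nat set set \<Rightarrow> nat set set" where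
  "gnb_separators C = {c \<inter> c' | c c'. c \<in> C \<and> c' \<in> C \<and> c \<noteq> c' \<and> card (c \<inter> c') = 2}"

definition multiplicity_in :: "nat set set \<Rightarrow> nat set \<Rightarrow> nat" where
  "multiplicity_in C S = card {c \<in> C. S \<subseteq> c}"

text \<open>
  \<open>J\<close> is the edge set of a tree on the set of clusters; its defining property is that
  \<open>c \<inter> c'\<close> is contained in every cluster on the path from \<open>c\<close> to \<open>c'\<close>.
\<close>

definition junction_tree :: "'i set set \<Rightarrow> 'i set set set \<Rightarrow> bool" where
  "junction_tree C J \<longleftrightarrow>
     tree C J \<and> (\<forall>p. simple_path C J p \<longrightarrow> (\<forall>c\<in>set p. hd p \<inter> last p \<subseteq> c))"

text \<open>
  The separator carried by an edge \<open>e = {c, c'}\<close> of a junction tree is \<open>\<Inter>e = c \<inter> c'\<close>. A separator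
  joining \<open>\<nu>\<close> parts does so in a tree-like way by \<open>\<nu> - 1\<close> edges, so it is counted once for every edge
  carrying it.
\<close>

definition structure_density :: "('i set \<Rightarrow> real) \<Rightarrow> 'i set set \<Rightarrow> 'i set set set \<Rightarrow> real" where
  "structure_density p C J =
     (\<Prod>c\<in>C. p c) / (\<Prod>S\<in>Inter ` J. p S ^ card {e \<in> J. \<Inter>e = S})"

section \<open>Joint density and its marginals\<close>

text \<open>
  The joint density/mass function is taken with respect to Lebesgue measure in the explanatory
  variables and counting measure on the countable set \<open>K\<close> of classes.
\<close>

definition reference_measure :: "nat set \<Rightarrow> 'y set \<Rightarrow> ((nat \<Rightarrow> real) \<times> 'y) measure" where
  "reference_measure D K = (\<Pi>\<^sub>M i\<in>D. lborel) \<Otimes>\<^sub>M count_space K"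

text \<open>
  \<open>marginal D K f x y A\<close> is the marginal of \<open>f\<close> for the variables with index in \<open>A\<close>, evaluated at
  the coordinates \<open>x i\<close> for \<open>i \<in> A - {0}\<close>, and at \<open>y\<close> if \<open>0 \<in> A\<close>: all other variables are
  integrated (summed) out.
\<close>

definition marginal ::
  "nat set \<Rightarrow> 'y set \<Rightarrow> ((nat \<Rightarrow> real) \<times> 'y \<Rightarrow> ennreal) \<Rightarrow> (nat \<Rightarrow> real) \<Rightarrow> 'y \<Rightarrow> nat set \<Rightarrow> real" where
  "marginal D K f x y A =
     enn2real (\<integral>\<^sup>+u. (let v = merge (A - {0}) (D - A) (x, u)
                      in if 0 \<in> A then f (v, y) else (\<integral>\<^sup>+y'. f (v, y') \<partial>count_space K))
               \<partial>(\<Pi>\<^sub>M i\<in>D - A. lborel))"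

end

theory Submission
  imports Defs
begin

text \<open>
  The identity holds for every function \<open>p\<close> on sets of indices, because it only compares how often
  each separator occurs. In a junction tree \<open>J\<close> the clusters containing a fixed index \<open>s \<noteq> 0\<close>
  induce a subtree, so the separator \<open>{0, s}\<close> is carried by \<open>deg s - 1\<close> edges of \<open>J\<close>, where
  \<open>deg s\<close> is the degree of \<open>s\<close> in the forest. All other edges carry \<open>{0}\<close>; since \<open>J\<close> has
  one edge less than there are clusters, i.e. forest edges, the handshake lemma leaves
  \<open>|V| - |E| - 1\<close> of them, which is one less than the number of trees. A junction tree is built by
  removing leaf edges from the forest.
\<close>

section \<open>Paths and joined vertices\<close>

lemma simple_path_mono:
  assumes "simple_path V E p" "V \<subseteq> V'" "E \<subseteq> E'"
  shows "simple_path V' E' p"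
  using assms by (auto simp: simple_path_def intro: successively_mono)

lemma simple_path_restrict:
  assumes "simple_path V E p" "set p \<subseteq> V'"
    and "\<And>x y. x \<in> set p \<Longrightarrow> y \<in> set p \<Longrightarrow> {x, y} \<in> E \<Longrightarrow> {x, y} \<in> E'"
  shows "simple_path V' E' p"
  using assms(1,2) successively_mono[of "\<lambda>x y. {x, y} \<in> E" p "\<lambda>x y. {x, y} \<in> E'"] assms(3)
  by (simp add: simple_path_def)

lemma simple_path_rev: "simple_path V E (rev p) \<longleftrightarrow> simple_path V E p"
  by (simp add: simple_path_def insert_commute)

lemma joined_mono: "joined V E u v \<Longrightarrow> V \<subseteq> V' \<Longrightarrow> E \<subseteq> E' \<Longrightarrow> joined V' E' u v"
  unfolding joined_def using simple_path_mono by blast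

lemma joined_refl: "u \<in> V \<Longrightarrow> joined V E u u"
  unfolding joined_def by (rule exI[of _ "[u]"]) (simp add: simple_path_def)

lemma joined_in:
  assumes "joined V E u v"
  shows "u \<in> V" "v \<in> V"
  using assms by (auto simp: joined_def simple_path_def)

lemma joined_sym: "joined V E u v \<Longrightarrow> joined V E v u"
  unfolding joined_def
  by (metis hd_rev last_rev simple_path_rev)

text \<open>Paths are lists without repetition, so a path already visiting \<open>w\<close> is cut
  off at \<open>w\<close>; only otherwise is it extended.\<close>

lemma joined_step:
  assumes "joined V E u v" "{v, w} \<in> E" "w \<in> V"
  shows "joined V E u w"
proof -
  obtain p where p: "simple_path V E p" "hd p = u" "last p = v"
    using assms(1) by (auto simp: joined_def)
  show ?thesis
  proof (cases "w \<in> set p")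
    case True
    then obtain xs ys where eq: "p = xs @ w # ys"
      by (auto simp: in_set_conv_decomp)
    have "simple_path V E (xs @ [w])"
      using p(1) by (auto simp: eq simple_path_def successively_append_iff)
    moreover have "hd (xs @ [w]) = u"
      using p(2) by (cases xs) (auto simp: eq)
    ultimately show ?thesis
      unfolding joined_def by (intro exI[of _ "xs @ [w]"]) simp
  next
    case False
    have "simple_path V E (p @ [w])"
      using p assms False by (auto simp: simple_path_def successively_append_iff)
    moreover have "hd (p @ [w]) = u"
      using p by (cases p) (auto simp: simple_path_def)
    ultimately show ?thesis
      unfolding joined_def by (intro exI[of _ "p @ [w]"]) simp
  qed
qed

text \<open>Induction on the far end of a connection, so that later arguments need not handle path
  lists.\<close>

lemma joined_induct [consumes 1, case_names refl step]:
  assumes "joined V E u v"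
    and "P u"
    and "\<And>v w. P v \<Longrightarrow> joined V E u v \<Longrightarrow> {v, w} \<in> E \<Longrightarrow> w \<in> V \<Longrightarrow> P w"
  shows "P v"
proof -
  \<comment> \<open>The conjunct \<open>joined V E u (last p)\<close> is carried along because the
    step rule has it as a premise.\<close>
  have "P (last p) \<and> joined V E u (last p)" if "simple_path V E p" "hd p = u" for p
    using that
  proof (induction p rule: rev_induct)
    case Nil
    then show ?case by (simp add: simple_path_def)
  next
    case (snoc w p)
    show ?case
    proof (cases "p = []")
      case True
      then show ?thesis
        using snoc.prems assms(2) by (auto simp: simple_path_def intro: joined_refl)
    next
      case False
      then have sp: "simple_path V E p" "hd p = u" "{last p, w} \<in> E" "w \<in> V"
        using snoc.prems by (auto simp: simple_path_def successively_append_iff)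
      then show ?thesis
        using snoc.IH assms(3) joined_step by fastforce
    qed
  qed
  then show ?thesis
    using assms(1) by (auto simp: joined_def)
qed

lemma joined_trans:
  assumes "joined V E v w" "joined V E u v"
  shows "joined V E u w"
  using assms by (induction rule: joined_induct) (auto intro: joined_step)

text \<open>One crossing of the new edge suffices: a step along it leads to its other end, and
  crossing back returns to a vertex that was reachable before.\<close>

lemma joined_insert_cases:
  assumes "joined V (insert {a, b} E) u v" "a \<in> V" "b \<in> V"
  shows "joined V E u v \<or> joined V E u a \<and> joined V E b v \<or> joined V E u b \<and> joined V E a v"
  using assms(1)
proof (induction rule: joined_induct)
  case refl
  then show ?case
    using assms(1) by (auto intro: joined_refl dest: joined_in)
next
  case (step v w)
  show ?case
  proof (cases "{v, w} \<in> E")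
    case True
    then show ?thesis
      using step joined_step by metis
  next
    case False
    then have "v = a \<and> w = b \<or> v = b \<and> w = a"
      using step by (auto simp: doubleton_eq_iff)
    then show ?thesis
      using step.IH joined_refl[OF assms(2)] joined_refl[OF assms(3)] by (metis joined_sym joined_trans)
  qed
qed

section \<open>Forests\<close>

definition component :: "'v set \<Rightarrow> 'v set set \<Rightarrow> 'v \<Rightarrow> 'v set" where
  "component V E v = {u \<in> V. joined V E v u}"

lemma component_self: "v \<in> V \<Longrightarrow> v \<in> component V E v"
  by (simp add: component_def joined_refl)

lemma component_eq_iff:
  assumes "v \<in> V"
  shows "component V E u = component V E v \<longleftrightarrow> joined V E u v"
proof
  assume "component V E u = component V E v"
  then show "joined V E u v"
    using component_self[OF assms] by (auto simp: component_def)
next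
  assume "joined V E u v"
  then show "component V E u = component V E v"
    unfolding component_def by (blast intro: joined_trans joined_sym)
qed

lemma component_eq: "u \<in> component V E v \<Longrightarrow> component V E u = component V E v"
  using component_eq_iff[of u V E v] by (auto simp: component_def)

lemma disjoint_components:
  assumes "A \<in> component V E ` V" "B \<in> component V E ` V" "A \<noteq> B"
  shows "A \<inter> B = {}"
proof (rule ccontr)
  assume "A \<inter> B \<noteq> {}"
  then obtain x where "x \<in> A" "x \<in> B" by blast
  then have "component V E x = A" "component V E x = B"
    using assms(1,2) component_eq by (metis imageE)+
  then show False
    using assms(3) by simp
qed

section \<open>Acyclic edge sets\<close>

lemma simple_graph_iff: "simple_graph V E \<longleftrightarrow> finite V \<and> (\<forall>e\<in>E. card e = 2 \<and> e \<subseteq> V)"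
  by (fastforce simp: simple_graph_def card_2_iff)

lemma cycle_mono: "cycle E p \<Longrightarrow> E \<subseteq> E' \<Longrightarrow> cycle E' p"
  by (auto simp: cycle_def intro: successively_mono)

text \<open>Acyclicity depends on the edges alone, so the vertex set may be replaced by any finite
  set covering the remaining edges. This serves both to pass to subtrees and to drop isolated
  vertices.\<close>

lemma forest_restrict:
  assumes "forest V E" "E' \<subseteq> E" "finite W" "\<Union>E' \<subseteq> W"
  shows "forest W E'"
proof -
  have "\<not> cycle E' p" for p
    using assms(1,2) cycle_mono[of E' p E] by (auto simp: forest_def)
  moreover have "card e = 2 \<and> e \<subseteq> W" if "e \<in> E'" for e
    using assms that by (auto simp: forest_def simple_graph_iff)
  ultimately show ?thesis
    using assms(3) by (simp add: forest_def simple_graph_iff)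
qed

lemma forest_mono: "forest V E \<Longrightarrow> E' \<subseteq> E \<Longrightarrow> forest V E'"
  by (rule forest_restrict) (auto simp: forest_def simple_graph_iff)

lemma forest_edge:
  assumes "forest V E" "e \<in> E"
  shows "card e = 2" "e \<subseteq> V"
  using assms by (auto simp: forest_def simple_graph_iff)

lemma forest_finite:
  assumes "forest V E"
  shows "finite V" "finite E"
proof -
  show "finite V"
    using assms by (simp add: forest_def simple_graph_def)
  moreover have "E \<subseteq> Pow V"
    using forest_edge(2)[OF assms] by blast
  ultimately show "finite E"
    by (meson finite_Pow_iff finite_subset)
qed

text \<open>The edge \<open>{a, b}\<close> would close a path from \<open>a\<close> to
  \<open>b\<close> to a cycle. The path has at least three vertices, since a path on two vertices
  would be the edge \<open>{a, b}\<close> itself.\<close>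

lemma forest_not_joined:
  assumes "forest V (insert {a, b} E)" "{a, b} \<notin> E"
  shows "\<not> joined V E a b"
proof
  assume "joined V E a b"
  then obtain p where p: "simple_path V E p" "hd p = a" "last p = b"
    by (auto simp: joined_def)
  have "a \<noteq> b"
    using forest_edge(1)[OF assms(1), of "{a, b}"] by auto
  obtain x y zs where eq: "p = x # y # zs"
    using p \<open>a \<noteq> b\<close> by (cases p rule: remdups_adj.cases) (auto simp: simple_path_def)
  then have "length p \<ge> 3"
    using p assms(2) by (cases zs) (auto simp: simple_path_def)
  moreover have "simple_path V (insert {a, b} E) p"
    using p(1) by (rule simple_path_mono) auto
  moreover have "{last p, hd p} = {a, b}"
    using p(2,3) by auto
  ultimately have "cycle (insert {a, b} E) p"
    by (simp add: cycle_def simple_path_def)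
  then show False
    using assms(1) by (auto simp: forest_def)
qed

text \<open>Euler's formula for forests. Without edges all components are singletons; each new edge
  joins two different components, by \<open>forest_not_joined\<close>, and so lowers their number by
  one.\<close>

lemma forest_card:
  assumes "forest V E"
  shows "card (component V E ` V) + card E = card V"
  using forest_finite(2)[OF assms] assms
proof (induction E rule: finite_induct)
  case empty
  have "component V {} v = {v}" if "v \<in> V" for v
  proof -
    have "u = v" if "joined V {} v u" for u
      using that by (induction rule: joined_induct) auto
    then show ?thesis
      using component_self[OF \<open>v \<in> V\<close>, of "{}"] by (auto simp: component_def)
  qed
  then have "component V {} ` V = (\<lambda>v. {v}) ` V"
    by (intro image_cong) auto
  then show ?case
    by (simp add: card_image)
next
  case (insert e E)
  obtain a b where e: "e = {a, b}" and ab: "a \<in> V" "b \<in> V"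
    using insert.prems by (auto simp: forest_def simple_graph_def)
  note fin = forest_finite(1)[OF insert.prems]
  let ?c = "component V E" and ?c' = "component V (insert e E)"
  have nj: "\<not> joined V E a b"
    using insert.prems insert.hyps(2) unfolding e by (rule forest_not_joined)
  have mono: "joined V (insert e E) u v" if "joined V E u v" for u v
    using that by (rule joined_mono) auto
  have jab: "joined V (insert e E) a b"
    using joined_step[OF joined_refl[OF ab(1)], of b] ab by (simp add: e)
  have merged: "?c' v = ?c a \<union> ?c b" if v: "v \<in> ?c a \<union> ?c b" for v
  proof -
    have "joined V (insert e E) a u \<longleftrightarrow> joined V E a u \<or> joined V E b u" if "u \<in> V" for u
      using joined_insert_cases[of V a b E a u] ab mono jab joined_trans unfolding e[symmetric] by metis
    then have "?c' a = ?c a \<union> ?c b"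
      by (auto simp: component_def)
    moreover have "?c' v = ?c' a"
      using v by (intro component_eq) (simp add: calculation)
    ultimately show ?thesis by simp
  qed
  have unmerged: "?c' v = ?c v" if v: "v \<in> V" "v \<notin> ?c a \<union> ?c b" for v
  proof -
    have "\<not> joined V E v a" "\<not> joined V E v b"
      using v joined_sym unfolding component_def by fastforce+
    then show ?thesis
      using joined_insert_cases[of V a b E v] ab mono unfolding e[symmetric] component_def by blast
  qed
  have sub: "?c v \<subseteq> V" for v by (auto simp: component_def)
  \<comment> \<open>The components of \<open>a\<close> and \<open>b\<close> are replaced by their
    union and all others survive.\<close>
  have "?c' ` V = insert (?c a \<union> ?c b) (?c ` V - {?c a, ?c b})" (is "_ = insert _ ?R")
  proof (intro equalityI subsetI)
    fix A assume "A \<in> ?c' ` V"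
    then obtain v where v: "v \<in> V" "A = ?c' v" by auto
    show "A \<in> insert (?c a \<union> ?c b) ?R"
    proof (cases "v \<in> ?c a \<union> ?c b")
      case True
      then show ?thesis using merged v by simp
    next
      case False
      then have "?c v \<noteq> ?c a" "?c v \<noteq> ?c b"
        using component_self[OF v(1), of E] by auto
      then show ?thesis using unmerged[OF v(1) False] v by auto
    qed
  next
    fix A assume "A \<in> insert (?c a \<union> ?c b) ?R"
    then consider "A = ?c a \<union> ?c b" | v where "v \<in> V" "A = ?c v" "?c v \<noteq> ?c a" "?c v \<noteq> ?c b"
      by auto
    then show "A \<in> ?c' ` V"
    proof cases
      case 1
      then show ?thesis
        using merged[of a] component_self[OF ab(1), of E] ab by auto
    next
      case 2
      then have "v \<notin> ?c a \<union> ?c b"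
        using component_eq[of v V E] by auto
      then show ?thesis
        using unmerged[OF 2(1)] 2(1,2) by (metis imageI)
    qed
  qed
  \<comment> \<open>If the union were an old component it would contain \<open>a\<close> and hence
    equal \<open>?c a\<close>, which \<open>?R\<close> excludes.\<close>
  moreover have "?c a \<union> ?c b \<notin> ?R"
  proof
    assume "?c a \<union> ?c b \<in> ?R"
    then obtain v where "?c a \<union> ?c b = ?c v" "?c v \<noteq> ?c a" by auto
    then show False
      using component_eq[of a V E v] component_self[OF ab(1), of E] by auto
  qed
  ultimately have "card (?c' ` V) = Suc (card ?R)"
    using fin by simp
  \<comment> \<open>The second fact makes the truncated subtraction in the first exact.\<close>
  moreover have "card ?R = card (?c ` V) - 2" and "card (?c ` V) \<ge> 2"
  proof -
    have two: "card {?c a, ?c b} = 2" "{?c a, ?c b} \<subseteq> ?c ` V"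
      using nj ab by (auto simp: card_2_iff component_eq_iff)
    then show "card ?R = card (?c ` V) - 2" "card (?c ` V) \<ge> 2"
      using card_Diff_subset[of "{?c a, ?c b}" "?c ` V"] card_mono[of "?c ` V" "{?c a, ?c b}"] fin by auto
  qed
  moreover have "card (?c ` V) + card E = card V"
    using insert.IH insert.prems forest_mono by blast
  ultimately show ?case
    using insert.hyps by simp
qed

lemma tree_card:
  assumes "tree V E"
  shows "Suc (card E) = card V"
proof -
  have "component V E ` V = {V}"
    using assms by (auto simp: tree_def component_def)
  then show ?thesis
    using forest_card[of V E] assms by (simp add: tree_def)
qed

section \<open>Degree sums and leaves\<close>

lemma handshake:
  assumes "forest V E"
  shows "(\<Sum>v\<in>V. card {e \<in> E. v \<in> e}) = 2 * card E"
proof -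
  have "(\<Sum>v\<in>V. card {e \<in> E. v \<in> e}) = (\<Sum>e\<in>E. card {v \<in> V. v \<in> e})"
    using forest_finite[OF assms] by (intro sum_multicount_gen) auto
  also have "\<dots> = (\<Sum>e\<in>E. 2)"
  proof (rule sum.cong)
    fix e assume "e \<in> E"
    then show "card {v \<in> V. v \<in> e} = 2"
      using forest_edge[OF assms, of e] by (simp add: Collect_conj_eq Int_absorb1)
  qed simp
  finally show ?thesis by simp
qed

text \<open>An averaging argument: a forest has fewer edges than vertices, so by the handshake lemma
  the degrees cannot all be at least 2.\<close>

lemma forest_has_leaf:
  assumes "forest V E" "E \<noteq> {}"
  obtains i j where "i \<noteq> j" "{i, j} \<in> E" "\<And>e. e \<in> E \<Longrightarrow> i \<in> e \<Longrightarrow> e = {i, j}"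
proof -
  note fin = forest_finite[OF assms(1)]
  \<comment> \<open>Isolated vertices are discarded, so that degree below 2 means degree exactly
    one.\<close>
  let ?V = "\<Union>E"
  have "?V \<subseteq> V"
    using forest_edge(2)[OF assms(1)] by blast
  then have f: "forest ?V E"
    using finite_subset[OF _ fin(1)] by (intro forest_restrict[OF assms(1)]) simp_all
  have "?V \<noteq> {}"
    using assms(2) forest_edge(1)[OF assms(1)] by fastforce
  then have "card (component ?V E ` ?V) > 0"
    using forest_finite(1)[OF f] by (simp add: card_gt_0_iff)
  then have "card E < card ?V"
    using forest_card[OF f] by linarith
  then have "\<not> (\<forall>v\<in>?V. 2 \<le> card {e \<in> E. v \<in> e})"
    using handshake[OF f] sum_bounded_below[of ?V 2 "\<lambda>v. card {e \<in> E. v \<in> e}"] by auto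
  then obtain i where i: "i \<in> ?V" "card {e \<in> E. i \<in> e} < 2"
    by force
  then obtain e where e: "e \<in> E" "i \<in> e" by blast
  obtain x y where xy: "e = {x, y}" "x \<noteq> y"
    using forest_edge(1)[OF assms(1) e(1)] unfolding card_2_iff by blast
  define j where "j = (if x = i then y else x)"
  have j: "i \<noteq> j" "e = {i, j}"
    using xy e(2) by (auto simp: j_def)
  have only: "e' = e" if "e' \<in> E" "i \<in> e'" for e'
  proof -
    have "card {e \<in> E. i \<in> e} \<le> Suc 0"
      using i(2) by simp
    then have "\<forall>x\<in>{e \<in> E. i \<in> e}. \<forall>y\<in>{e \<in> E. i \<in> e}. x = y"
      using fin(2) card_le_Suc0_iff_eq[of "{e \<in> E. i \<in> e}"] by simp
    then show ?thesis
      using that e by blast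
  qed
  show ?thesis
    using j(1)
  proof (rule that)
    show "{i, j} \<in> E" "\<And>e'. e' \<in> E \<Longrightarrow> i \<in> e' \<Longrightarrow> e' = {i, j}"
      using e(1) only unfolding j(2) by blast+
  qed
qed

text \<open>Used to show that a vertex with a single incident edge lies on no cycle.\<close>

lemma cycle_two_neighbours:
  assumes "cycle E p" "v \<in> set p"
  obtains u w where "u \<noteq> w" "{u, v} \<in> E" "{v, w} \<in> E"
proof -
  obtain xs ys where p: "p = xs @ v # ys"
    using assms(2) by (auto simp: in_set_conv_decomp)
  \<comment> \<open>Predecessor and successor of \<open>v\<close> in cyclic order, wrapping around
    at the ends of the list.\<close>
  let ?u = "if xs = [] then last ys else last xs"
  let ?w = "if ys = [] then hd xs else hd ys"
  have len: "length xs + length ys \<ge> 2"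
    using assms(1) by (simp add: p cycle_def)
  have "?u \<noteq> ?w"
  \<comment> \<open>If \<open>v\<close> is an end of the list, its neighbours are the first and last
    entries of the rest, which has at least two entries.\<close>
  proof (cases "xs = [] \<or> ys = []")
    case True
    have "hd zs \<noteq> last zs" if "length zs \<ge> 2" "distinct zs" for zs :: "'a list"
      using that by (cases zs) auto
    from this[of xs] this[of ys] show ?thesis
      using True len assms(1) by (auto simp: p cycle_def)
  next
    case False
    then have "last xs \<in> set xs" "hd ys \<in> set ys" by auto
    moreover have "set xs \<inter> set ys = {}"
      using assms(1) by (simp add: p cycle_def)
    ultimately have "last xs \<noteq> hd ys"
      by (metis disjoint_iff)
    then show ?thesis
      using False by simp
  qed
  moreover have "{?u, v} \<in> E"
    using assms(1) len by (cases "xs = []") (simp_all add: p cycle_def successively_append_iff split: if_splits)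
  moreover have "{v, ?w} \<in> E"
    using assms(1) len
    by (cases "ys = []"; cases "xs = []")
      (simp_all add: p cycle_def successively_append_iff successively_Cons)
  ultimately show ?thesis
    by (rule that)
qed

section \<open>Junction trees\<close>

text \<open>The new vertex \<open>w\<close> has \<open>v\<close> as its only neighbour, so no cycle
  passes through \<open>w\<close>, and a cycle avoiding \<open>w\<close> lies in \<open>E\<close>.
  For connectedness it is enough to reach every vertex from \<open>v\<close>.\<close>

lemma tree_add_leaf:
  assumes "tree V E" "v \<in> V" "w \<notin> V"
  shows "tree (insert w V) (insert {w, v} E)"
proof -
  have f: "forest V E" and j: "\<And>x y. x \<in> V \<Longrightarrow> y \<in> V \<Longrightarrow> joined V E x y"
    using assms(1) by (auto simp: tree_def)
  have wE: "w \<notin> e" if "e \<in> E" for e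
    using forest_edge(2)[OF f that] assms(3) by auto
  have "\<not> cycle (insert {w, v} E) p" for p
  proof
    assume c: "cycle (insert {w, v} E) p"
    show False
    proof (cases "w \<in> set p")
      case True
      obtain x y where "x \<noteq> y" "{x, w} \<in> insert {w, v} E" "{w, y} \<in> insert {w, v} E"
        using c True by (rule cycle_two_neighbours)
      then show False
        using wE by (auto simp: doubleton_eq_iff)
    next
      case False
      have ne: "p \<noteq> []"
        using c by (auto simp: cycle_def)
      have E: "{x, y} \<in> E" if "x \<in> set p" "y \<in> set p" "{x, y} \<in> insert {w, v} E" for x y
        using that False by (auto simp: doubleton_eq_iff)
      have "successively (\<lambda>x y. {x, y} \<in> insert {w, v} E) p"
        using c by (simp add: cycle_def)
      then have "successively (\<lambda>x y. {x, y} \<in> E) p"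
        by (rule successively_mono) (rule E)
      moreover have "{last p, hd p} \<in> E"
        using c E[of "last p" "hd p"] ne by (simp add: cycle_def)
      ultimately have "cycle E p"
        using c by (simp add: cycle_def)
      then show False
        using f by (auto simp: forest_def)
    qed
  qed
  moreover have "simple_graph (insert w V) (insert {w, v} E)"
  proof -
    have "w \<noteq> v" using assms(2,3) by auto
    then show ?thesis
      using f assms(2) by (auto simp: forest_def simple_graph_iff)
  qed
  moreover have "joined (insert w V) (insert {w, v} E) v x" if "x \<in> insert w V" for x
  proof (cases "x = w")
    case True
    then show ?thesis
      using joined_step[OF joined_refl, of v "insert w V" w "insert {w, v} E"] assms(2)
      by (simp add: insert_commute)
  next
    case False
    then show ?thesis
      using that by (intro joined_mono[OF j[OF assms(2)]]) auto
  qed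
  ultimately show ?thesis
    unfolding tree_def forest_def by (blast intro: joined_trans joined_sym)
qed

text \<open>Inside a path, \<open>w\<close> would need two different neighbours, but it has only
  \<open>v\<close>. Hence \<open>w\<close> can only be an end of the path; reversal reduces the case
  of the last vertex to that of the first.\<close>

lemma simple_path_add_leaf:
  assumes "simple_path (insert w V) (insert {w, v} E) p" "w \<notin> \<Union>E" "w \<notin> V"
  obtains "simple_path V E p"
    | "p = [w]"
    | q where "p = w # q \<or> rev p = w # q" "simple_path V E q" "hd q = v"
proof (cases "w \<in> set p")
  case False
  have "{x, y} \<in> E" if "x \<in> set p" "y \<in> set p" "{x, y} \<in> insert {w, v} E" for x y
    using that False by (auto simp: doubleton_eq_iff)
  moreover have "set p \<subseteq> V"
    using assms(1) False by (auto simp: simple_path_def)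
  ultimately have "simple_path V E p"
    using simple_path_restrict[OF assms(1)] by blast
  then show ?thesis by (rule that(1))
next
  case True
  have start: "simple_path V E q \<and> hd q = v"
    if sp: "simple_path (insert w V) (insert {w, v} E) (w # q)" "q \<noteq> []" for q
  proof -
    have q: "simple_path (insert w V) (insert {w, v} E) q" "w \<notin> set q"
      using sp by (auto simp: simple_path_def successively_Cons)
    have "{x, y} \<in> E" if "x \<in> set q" "y \<in> set q" "{x, y} \<in> insert {w, v} E" for x y
      using that q(2) by (auto simp: doubleton_eq_iff)
    moreover have "set q \<subseteq> V"
      using q by (auto simp: simple_path_def)
    ultimately have "simple_path V E q"
      using simple_path_restrict[OF q(1)] by blast
    moreover have "{w, hd q} \<in> insert {w, v} E"
      using sp by (simp add: simple_path_def successively_Cons)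
    moreover have "{w, hd q} \<notin> E"
      using assms(2) by auto
    ultimately have "simple_path V E q" "{w, hd q} = {w, v}"
      by auto
    then show ?thesis
      by (auto simp: doubleton_eq_iff)
  qed
  obtain xs ys where p: "p = xs @ w # ys"
    using True by (auto simp: in_set_conv_decomp)
  have "xs = [] \<or> ys = []"
  proof (rule ccontr)
    assume ne: "\<not> (xs = [] \<or> ys = [])"
    then have "{last xs, w} \<in> insert {w, v} E" "{w, hd ys} \<in> insert {w, v} E"
      using assms(1) by (auto simp: p simple_path_def successively_append_iff successively_Cons)
    moreover have "{x, w} \<notin> E" "{w, x} \<notin> E" for x
      using assms(2) by auto
    ultimately have "{last xs, w} = {w, v}" "{w, hd ys} = {w, v}"
      by auto
    then have "last xs = hd ys"
      by (auto simp: doubleton_eq_iff)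
    moreover have "last xs \<in> set xs" "hd ys \<in> set ys"
      using ne by auto
    moreover have "set xs \<inter> set ys = {}"
      using assms(1) by (simp add: p simple_path_def)
    ultimately show False
      by (metis disjoint_iff)
  qed
  then consider "p = [w]" | q where "q \<noteq> []" "p = w # q \<or> rev p = w # q"
    using p by (cases "xs = []"; cases "ys = []") auto
  then show ?thesis
  proof cases
    case 1
    then show ?thesis by (rule that(2))
  next
    case 2
    have "simple_path (insert w V) (insert {w, v} E) (w # q)"
      using 2(2) assms(1) by (metis simple_path_rev)
    then have "simple_path V E q \<and> hd q = v"
      using 2(1) by (rule start)
    then show ?thesis
      using that(3)[OF 2(2)] by simp
  qed
qed

text \<open>What \<open>c\<close> shares with an old cluster lies in \<open>c0\<close>. So on a path
  that starts with \<open>c\<close> and continues from \<open>c0\<close> to \<open>last q\<close>,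
  \<open>c \<inter> last q\<close> is contained in \<open>c0 \<inter> last q\<close>, which the old
  tree already passes on to every cluster of \<open>q\<close>.\<close>

lemma junction_tree_add_leaf:
  assumes "junction_tree C J" "c0 \<in> C" "c \<notin> C"
    and "\<And>c'. c' \<in> C \<Longrightarrow> c \<inter> c' \<subseteq> c0"
  shows "junction_tree (insert c C) (insert {c, c0} J)"
proof -
  have t: "tree C J"
    and run: "\<And>p c'. simple_path C J p \<Longrightarrow> c' \<in> set p \<Longrightarrow> hd p \<inter> last p \<subseteq> c'"
    using assms(1) by (auto simp: junction_tree_def)
  have "c \<notin> \<Union>J"
    using t assms(3) forest_edge(2)[of C J] by (auto simp: tree_def)
  have leaf: "c \<inter> last q \<subseteq> c'" if "simple_path C J q" "hd q = c0" "c' \<in> set (c # q)" for q c'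
  proof -
    have "last q \<in> C"
      using that(1) by (auto simp: simple_path_def)
    then show ?thesis
      using run[OF that(1), of c'] that assms(4)[of "last q"] by auto
  qed
  have "hd p \<inter> last p \<subseteq> c'" if p: "simple_path (insert c C) (insert {c, c0} J) p" "c' \<in> set p" for p c'
    using p(1) \<open>c \<notin> \<Union>J\<close> assms(3)
  proof (cases rule: simple_path_add_leaf)
    case 1
    then show ?thesis using run p by blast
  next
    case 2
    then show ?thesis using p by simp
  next
    case (3 q)
    have "q \<noteq> []"
      using 3(2) by (simp add: simple_path_def)
    have "hd p \<inter> last p = c \<inter> last q"
      using 3(1)
    proof
      assume "rev p = c # q"
      then have "last p = hd (c # q)" "hd p = last (c # q)"
        by (metis hd_rev, metis last_rev)
      then show ?thesis using \<open>q \<noteq> []\<close> by auto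
    qed (use \<open>q \<noteq> []\<close> in auto)
    moreover have "c' \<in> set (c # q)"
      using 3(1) p(2) by (metis set_rev)
    ultimately show ?thesis
      using leaf 3 by simp
  qed
  then show ?thesis
    unfolding junction_tree_def using tree_add_leaf[OF t assms(2,3)] by blast
qed

section \<open>Existence of a junction tree\<close>

lemma junction_tree_singleton: "junction_tree {c} {}"
proof -
  have "p = [c]" if "simple_path {c} {} p" for p
    using that by (cases p rule: remdups_adj.cases) (auto simp: simple_path_def)
  then have "hd p \<inter> last p \<subseteq> c'" if "simple_path {c} {} p" "c' \<in> set p" for p c'
    using that by fastforce
  moreover have "tree {c} {}"
    by (auto simp: tree_def forest_def simple_graph_def cycle_def
        successively_Cons numeral_3_eq_3 Suc_le_length_iff intro: joined_refl)
  ultimately show ?thesis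
    by (simp add: junction_tree_def)
qed

text \<open>Induction by removing a leaf edge \<open>{i, j}\<close> with leaf \<open>i\<close>: its
  cluster meets the remaining ones at most in \<open>z\<close> and \<open>j\<close>.\<close>

lemma forest_junction_tree:
  assumes "forest V E" "E \<noteq> {}" "z \<notin> V"
  shows "\<exists>J. junction_tree (insert z ` E) J"
  using forest_finite(2)[OF assms(1)] assms(1,2)
proof (induction E rule: finite_psubset_induct)
  case (psubset E)
  obtain i j where ij: "i \<noteq> j" "{i, j} \<in> E" and leaf: "\<And>e. e \<in> E \<Longrightarrow> i \<in> e \<Longrightarrow> e = {i, j}"
    using psubset.prems forest_has_leaf by metis
  let ?E = "E - {{i, j}}" and ?c = "insert z {i, j}"
  have E: "E = insert {i, j} ?E"
    using ij by blast
  have z: "z \<notin> e" if "e \<in> E" for e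
    using forest_edge(2)[OF psubset.prems(1) that] assms(3) by auto
  show ?case
  proof (cases "?E = {}")
    case True
    then have "E = {{i, j}}" using ij by blast
    then show ?thesis
      using junction_tree_singleton by auto
  next
    case False
    obtain J where J: "junction_tree (insert z ` ?E) J"
      using psubset.IH[of ?E] False forest_mono[OF psubset.prems(1), of ?E] ij by auto
    \<comment> \<open>The new cluster is attached to one containing \<open>j\<close>. If there is
      none, only \<open>z\<close> is shared, and any cluster will do.\<close>
    obtain e0 where e0: "e0 \<in> ?E" "j \<in> e0 \<or> (\<forall>e\<in>?E. j \<notin> e)"
      using False by blast
    have i: "i \<notin> e" if "e \<in> ?E" for e
      using that leaf by auto
    have "i \<noteq> z"
      using z[OF ij(2)] by auto
    have "junction_tree (insert ?c (insert z ` ?E)) (insert {?c, insert z e0} J)"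
    proof (rule junction_tree_add_leaf[OF J])
      show "?c \<notin> insert z ` ?E"
        using i \<open>i \<noteq> z\<close> by blast
      show "?c \<inter> c' \<subseteq> insert z e0" if "c' \<in> insert z ` ?E" for c'
        using that i e0 by blast
    qed (use e0 in blast)
    moreover have "insert ?c (insert z ` ?E) = insert z ` E"
      using E by blast
    ultimately show ?thesis by metis
  qed
qed

text \<open>By the running intersection property, a path between two clusters containing
  \<open>s\<close> stays among such clusters. They therefore induce a subtree, to which
  \<open>tree_card\<close> applies; an edge \<open>e\<close> belongs to it exactly when
  \<open>s \<in> \<Inter>e\<close>.\<close>

lemma junction_tree_card_containing:
  assumes "junction_tree C J" "c \<in> C" "s \<in> c"
  shows "Suc (card {e \<in> J. s \<in> \<Inter>e}) = card {c \<in> C. s \<in> c}"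
proof -
  let ?C = "{c \<in> C. s \<in> c}" and ?J = "{e \<in> J. s \<in> \<Inter>e}"
  have f: "forest C J" and conn: "\<And>c c'. c \<in> C \<Longrightarrow> c' \<in> C \<Longrightarrow> joined C J c c'"
    and run: "\<And>p c'. simple_path C J p \<Longrightarrow> c' \<in> set p \<Longrightarrow> hd p \<inter> last p \<subseteq> c'"
    using assms(1) by (auto simp: junction_tree_def tree_def)
  have "joined ?C ?J c c'" if c: "c \<in> ?C" "c' \<in> ?C" for c c'
  proof -
    obtain p where p: "simple_path C J p" "hd p = c" "last p = c'"
      using conn c by (auto simp: joined_def)
    then have "\<forall>c\<in>set p. s \<in> c"
      using run c by blast
    then have "simple_path ?C ?J p"
      using p(1) by (auto simp: simple_path_def intro: successively_mono)
    then show ?thesis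
      using p unfolding joined_def by blast
  qed
  moreover have "forest ?C ?J"
    using f
  proof (rule forest_restrict)
    show "\<Union>?J \<subseteq> ?C"
      using forest_edge(2)[OF f] by blast
  qed (use forest_finite(1)[OF f] in auto)
  ultimately have "tree ?C ?J"
    using assms(2,3) by (auto simp: tree_def)
  then show ?thesis
    by (rule tree_card)
qed

section \<open>Clusters and separators of a GNB forest\<close>

lemma card_gnb_clusters_containing:
  assumes "0 \<notin> \<Union>E" "s \<noteq> 0"
  shows "card {c \<in> gnb_clusters E. s \<in> c} = card {e \<in> E. s \<in> e}"
proof -
  have "{c \<in> gnb_clusters E. s \<in> c} = insert 0 ` {e \<in> E. s \<in> e}"
    using assms(2) by (auto simp: gnb_clusters_def)
  moreover have "inj_on (insert 0) {e \<in> E. s \<in> e}"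
    using assms(1) unfolding inj_on_def by (metis (mono_tags, lifting) UnionI insert_ident mem_Collect_eq)
  ultimately show ?thesis
    by (simp add: card_image)
qed

lemma prod_gnb_clusters:
  assumes "0 \<notin> \<Union>E"
  shows "(\<Prod>c\<in>gnb_clusters E. p c) = (\<Prod>e\<in>E. p (insert 0 e))"
proof -
  have "inj_on (insert 0) E"
    using assms unfolding inj_on_def by (metis UnionI insert_ident)
  then show ?thesis
    by (simp add: gnb_clusters_def prod.reindex)
qed

section \<open>Separators in terms of vertex degrees\<close>

lemma two_sets_inter:
  assumes "card e = 2" "card e' = 2" "e \<noteq> e'" "s \<in> e" "s \<in> e'"
  shows "e \<inter> e' = {s}"
  using assms by (auto simp: card_2_iff)

text \<open>Two different edges share at most one vertex, so two clusters meet in a pair exactly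
  when their edges share a vertex \<open>s\<close>; this requires degree at least 2.\<close>

lemma gnb_separators_eq:
  assumes "forest W E" "0 \<notin> W"
  shows "gnb_separators (gnb_clusters E) = (\<lambda>s. {0, s}) ` {s \<in> W. card {e \<in> E. s \<in> e} \<ge> 2}"
proof (intro equalityI subsetI)
  note edge = forest_edge[OF assms(1)] and fin = forest_finite[OF assms(1)]
  fix S
  {
    assume "S \<in> gnb_separators (gnb_clusters E)"
    then obtain c c' where c: "c \<in> insert 0 ` E" "c' \<in> insert 0 ` E" "c \<noteq> c'" "S = c \<inter> c'" "card S = 2"
      unfolding gnb_separators_def gnb_clusters_def by blast
    then obtain e e' where "e \<in> E" "c = insert 0 e" "e' \<in> E" "c' = insert 0 e'"
      by blast
    with c have e: "e \<in> E" "e' \<in> E" "e \<noteq> e'" "S = insert 0 (e \<inter> e')" "card S = 2"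
      by auto
    then have "e \<inter> e' \<noteq> {}"
      by auto
    then obtain s where s: "s \<in> e" "s \<in> e'" by blast
    then have "S = {0, s}"
      using e(4) two_sets_inter[OF edge(1)[OF e(1)] edge(1)[OF e(2)] e(3) s] by simp
    moreover have "s \<in> W"
      using edge(2) e s by blast
    moreover have "card {e, e'} \<le> card {e \<in> E. s \<in> e}"
      using fin(2) e s by (intro card_mono) auto
    ultimately show "S \<in> (\<lambda>s. {0, s}) ` {s \<in> W. card {e \<in> E. s \<in> e} \<ge> 2}"
      using e(3) by simp
  }
  {
    assume "S \<in> (\<lambda>s. {0, s}) ` {s \<in> W. card {e \<in> E. s \<in> e} \<ge> 2}"
    then obtain s where s: "s \<in> W" "S = {0, s}" "\<not> card {e \<in> E. s \<in> e} \<le> Suc 0"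
      by auto
    then obtain e e' where e: "e \<in> E" "e' \<in> E" "s \<in> e" "s \<in> e'" "e \<noteq> e'"
      using fin(2) by (subst (asm) card_le_Suc0_iff_eq) auto
    have "s \<noteq> 0" "0 \<notin> e" "0 \<notin> e'"
      using s assms(2) edge(2) e by auto
    then have "insert 0 e \<inter> insert 0 e' = S" "insert 0 e \<noteq> insert 0 e'" "card S = 2"
      using two_sets_inter[OF edge(1) edge(1) e(5,3,4)] e s by (auto simp: insert_ident)
    then show "S \<in> gnb_separators (gnb_clusters E)"
      using e unfolding gnb_separators_def gnb_clusters_def by blast
  }
qed

text \<open>The multiplicity of \<open>{0, s}\<close> is the degree of \<open>s\<close>. Vertices of
  degree 0 or 1 have exponent 0 by truncated subtraction, so the product may run over all of
  \<open>W\<close>.\<close>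

lemma prod_gnb_separators:
  fixes p :: "nat set \<Rightarrow> 'a::comm_monoid_mult"
  assumes "forest W E" "0 \<notin> W"
  shows "(\<Prod>S\<in>gnb_separators (gnb_clusters E). p S ^ (multiplicity_in (gnb_clusters E) S - 1)) =
    (\<Prod>s\<in>W. p {0, s} ^ (card {e \<in> E. s \<in> e} - 1))"
proof -
  let ?W = "{s \<in> W. card {e \<in> E. s \<in> e} \<ge> 2}"
  have 0: "0 \<notin> \<Union>E"
    using forest_edge(2)[OF assms(1)] assms(2) by blast
  have mult: "multiplicity_in (gnb_clusters E) {0, s} = card {e \<in> E. s \<in> e}" if "s \<in> W" for s
  proof -
    have "{c \<in> gnb_clusters E. {0, s} \<subseteq> c} = {c \<in> gnb_clusters E. s \<in> c}"
      by (auto simp: gnb_clusters_def)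
    then show ?thesis
      using card_gnb_clusters_containing[OF 0, of s] that assms(2)
      by (metis multiplicity_in_def)
  qed
  have "inj_on (\<lambda>s. {0, s}) ?W"
    by (auto simp: inj_on_def doubleton_eq_iff)
  then have "(\<Prod>S\<in>gnb_separators (gnb_clusters E). p S ^ (multiplicity_in (gnb_clusters E) S - 1)) =
      (\<Prod>s\<in>?W. p {0, s} ^ (card {e \<in> E. s \<in> e} - 1))"
    unfolding gnb_separators_eq[OF assms] by (simp add: prod.reindex mult)
  also have "\<dots> = (\<Prod>s\<in>W. p {0, s} ^ (card {e \<in> E. s \<in> e} - 1))"
    using forest_finite(1)[OF assms(1)]
  proof (intro prod.mono_neutral_left ballI)
    fix s assume "s \<in> W - ?W"
    then have "card {e \<in> E. s \<in> e} - 1 = 0" by auto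
    then show "p {0, s} ^ (card {e \<in> E. s \<in> e} - 1) = 1"
      by (metis power_0)
  qed auto
  finally show ?thesis .
qed

text \<open>The right-hand side does not mention \<open>J\<close>: how often each separator is
  carried is the same for all junction trees. The condition \<open>V = \<Union>E\<close> makes all
  degrees positive, so the subtractions are exact.\<close>

lemma gnb_junction_tree_separators:
  fixes p :: "nat set \<Rightarrow> 'a::comm_monoid_mult"
  assumes "forest V E" "0 \<notin> V" "V = \<Union>E" "junction_tree (gnb_clusters E) J"
  shows "(\<Prod>S\<in>Inter ` J. p S ^ card {e \<in> J. \<Inter>e = S}) =
    (\<Prod>s\<in>V. p {0, s} ^ (card {e \<in> E. s \<in> e} - 1)) * p {0} ^ (card (component V E ` V) - 1)"
proof -
  note edge = forest_edge[OF assms(1)] and fin = forest_finite[OF assms(1)]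
  let ?N = "\<lambda>S. card {e \<in> J. \<Inter>e = S}" and ?sep = "\<lambda>s::nat. {0, s}"
    and ?deg = "\<lambda>s. card {e \<in> E. s \<in> e}"
  have t: "tree (gnb_clusters E) J"
    using assms(4) by (simp add: junction_tree_def)
  then have fJ: "forest (gnb_clusters E) J"
    by (simp add: tree_def)
  note finJ = forest_finite(2)[OF fJ]
  have inter: "\<exists>e e'. e \<in> E \<and> e' \<in> E \<and> e \<noteq> e' \<and> \<Inter>j = insert 0 (e \<inter> e')" if j: "j \<in> J" for j
  proof -
    have "\<exists>c\<in>gnb_clusters E. \<exists>c'\<in>gnb_clusters E. c \<noteq> c' \<and> j = {c, c'}"
      using fJ j by (simp add: forest_def simple_graph_def)
    then obtain c c' where c: "c \<in> insert 0 ` E" "c' \<in> insert 0 ` E" "c \<noteq> c'" "j = {c, c'}"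
      unfolding gnb_clusters_def by (elim bexE conjE)
    obtain e where e: "c = insert 0 e" "e \<in> E"
      using c(1) by (rule imageE)
    obtain e' where e': "c' = insert 0 e'" "e' \<in> E"
      using c(2) by (rule imageE)
    have "e \<noteq> e'"
      using c(3) e(1) e'(1) by metis
    moreover have "\<Inter>j = insert 0 (e \<inter> e')"
      unfolding c(4) e(1) e'(1) by simp
    ultimately show ?thesis
      using e(2) e'(2) by blast
  qed
  \<comment> \<open>This turns the count of edges whose separator contains \<open>s\<close> into the
    count of edges carrying exactly \<open>{0, s}\<close>.\<close>
  have sep_iff: "s \<in> \<Inter>j \<longleftrightarrow> \<Inter>j = {0, s}" if "j \<in> J" "s \<in> V" for j s
  proof (rule iffI)
    assume s: "s \<in> \<Inter>j"
    obtain e e' where e: "e \<in> E" "e' \<in> E" "e \<noteq> e'" "\<Inter>j = insert 0 (e \<inter> e')"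
      using inter[OF \<open>j \<in> J\<close>] by (elim exE conjE)
    have "s \<noteq> 0"
      using that(2) assms(2) by metis
    then have "s \<in> e" "s \<in> e'"
      using s e(4) by auto
    then show "\<Inter>j = {0, s}"
      using e(4) two_sets_inter[OF edge(1)[OF e(1)] edge(1)[OF e(2)] e(3)] by simp
  qed simp
  have sub: "Inter ` J \<subseteq> insert {0} (?sep ` V)"
  proof
    fix S assume "S \<in> Inter ` J"
    then obtain j where j: "j \<in> J" "S = \<Inter>j" by auto
    obtain e e' where e: "e \<in> E" "S = insert 0 (e \<inter> e')"
      using inter[OF j(1)] unfolding j(2) by (elim exE conjE)
    show "S \<in> insert {0} (?sep ` V)"
    proof (cases "e \<inter> e' = {}")
      case False
      then obtain s where "s \<in> e" "s \<in> S" using e by auto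
      moreover have "s \<in> V"
        using \<open>s \<in> e\<close> e(1) edge(2) by blast
      ultimately have "S = {0, s}"
        using sep_iff[OF j(1), of s] j(2) by simp
      then show ?thesis
        using \<open>s \<in> V\<close> by blast
    qed (use e in simp)
  qed
  \<comment> \<open>Candidates carried by no edge count 0, so sums and products may be extended to
    \<open>{0}\<close> and all \<open>{0, s}\<close>, whether or not they occur in
    \<open>J\<close>.\<close>
  have out: "?N S = 0" if "S \<notin> Inter ` J" for S
    using that by (auto simp: card_eq_0_iff)
  have N: "?N {0, s} = ?deg s - 1" and deg: "?deg s \<ge> 1" if s: "s \<in> V" for s
  proof -
    obtain e where e: "e \<in> E" "s \<in> e"
      using s[unfolded assms(3)] by (rule UnionE)
    have "{e \<in> J. s \<in> \<Inter>e} = {e \<in> J. \<Inter>e = {0, s}}"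
      using s by (intro Collect_cong conj_cong refl sep_iff)
    moreover have "card {c \<in> gnb_clusters E. s \<in> c} = ?deg s"
      using assms(2) s unfolding assms(3) by (intro card_gnb_clusters_containing) metis+
    ultimately have "Suc (?N {0, s}) = ?deg s"
      using junction_tree_card_containing[OF assms(4), of "insert 0 e" s] e
      by (simp add: gnb_clusters_def)
    then show "?N {0, s} = ?deg s - 1" "?deg s \<ge> 1" by auto
  qed
  have inj: "inj_on ?sep V" and nin: "{0} \<notin> ?sep ` V" and finV: "finite (?sep ` V)"
    using assms(2) fin(1) by (auto simp: inj_on_def doubleton_eq_iff)
  \<comment> \<open>The edges of \<open>J\<close> are grouped by the separator they carry.\<close>
  have "card J = (\<Sum>S\<in>Inter ` J. ?N S)"
    using sum.image_gen[OF finJ, of "\<lambda>_. 1::nat" Inter] by simp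
  also have "\<dots> = (\<Sum>S\<in>insert {0} (?sep ` V). ?N S)"
    using sub out finV by (intro sum.mono_neutral_left) auto
  also have "\<dots> = ?N {0} + (\<Sum>s\<in>V. ?deg s - 1)"
    using nin finV by (simp add: sum.reindex[OF inj] N)
  finally have cardJ: "card J = ?N {0} + (\<Sum>s\<in>V. ?deg s - 1)" .
  have "(\<Sum>s\<in>V. ?deg s - 1) + card V = (\<Sum>s\<in>V. (?deg s - 1) + 1)"
    by (subst sum.distrib) simp
  also have "\<dots> = 2 * card E"
    unfolding handshake[OF assms(1), symmetric] using le_add_diff_inverse2[OF deg] by (intro sum.cong refl)
  finally have "(\<Sum>s\<in>V. ?deg s - 1) + card V = 2 * card E" .
  moreover have "Suc (card J) = card E"
  proof -
    have "inj_on (insert 0) E"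
      using assms(2,3) unfolding inj_on_def by (metis UnionI insert_ident)
    then show ?thesis
      using tree_card[OF t] by (simp add: gnb_clusters_def card_image)
  qed
  \<comment> \<open>The equations give \<open>?N {0} = (card E - 1) - (2 * card E - card V) = card V
    - card E - 1\<close>, which \<open>forest_card\<close> turns into the number of components minus
    one.\<close>
  ultimately have N0: "?N {0} = card (component V E ` V) - 1"
    using cardJ forest_card[OF assms(1)] by linarith
  have "(\<Prod>S\<in>Inter ` J. p S ^ ?N S) = (\<Prod>S\<in>insert {0} (?sep ` V). p S ^ ?N S)"
    using sub out finV by (intro prod.mono_neutral_left) auto
  also have "\<dots> = p {0} ^ ?N {0} * (\<Prod>s\<in>V. p {0, s} ^ (?deg s - 1))"
    using nin finV by (simp add: prod.reindex[OF inj] N)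
  finally show ?thesis
    by (simp add: N0 mult.commute)
qed

text \<open>The components partition the vertices and the edges, and a vertex keeps its full degree
  inside its own tree. The quotients of the single trees therefore multiply to one quotient for the
  whole forest.\<close>

lemma tree_components_product:
  fixes p :: "nat set \<Rightarrow> real"
  assumes "forest V E" "0 \<notin> V"
  shows "(\<Prod>(W, E')\<in>tree_components V E.
      (\<Prod>c\<in>gnb_clusters E'. p c) /
      (\<Prod>S\<in>gnb_separators (gnb_clusters E'). p S ^ (multiplicity_in (gnb_clusters E') S - 1))) =
    (\<Prod>c\<in>gnb_clusters E. p c) / (\<Prod>s\<in>V. p {0, s} ^ (card {e \<in> E. s \<in> e} - 1))"
    and "card (tree_components V E) = card (component V E ` V)"
proof -
  note edge = forest_edge[OF assms(1)] and fin = forest_finite[OF assms(1)]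
  let ?W = "component V E ` V" and ?E = "\<lambda>W. {e \<in> E. e \<subseteq> W}"
  have T: "tree_components V E = (\<lambda>W. (W, ?E W)) ` ?W"
    by (simp add: tree_components_def component_def image_image Let_def)
  \<comment> \<open>The edge set of a tree is determined by its vertex set, so products over trees
    become products over components.\<close>
  have inj: "inj_on (\<lambda>W. (W, ?E W)) ?W"
    by (auto simp: inj_on_def)
  show "card (tree_components V E) = card ?W"
    by (simp add: T card_image[OF inj])
  have WV: "W \<subseteq> V" if "W \<in> ?W" for W
    using that by (auto simp: component_def)
  \<comment> \<open>An edge that meets a component stays inside it. This gives both the partition of
    \<open>E\<close> and the equality of degrees.\<close>
  have closed: "e \<subseteq> W" if W: "W \<in> ?W" and e: "e \<in> E" "s \<in> e" "s \<in> W" for W e s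
  proof
    fix u assume "u \<in> e"
    have "u \<in> V" "s \<in> V"
      using edge(2) e \<open>u \<in> e\<close> by auto
    have "{s, u} = e \<or> u = s"
      using edge(1)[OF e(1)] e(2) \<open>u \<in> e\<close> by (auto simp: card_2_iff)
    then have "joined V E s u"
      using joined_step[OF joined_refl[OF \<open>s \<in> V\<close>], of u] joined_refl[OF \<open>s \<in> V\<close>] e \<open>u \<in> V\<close> by metis
    then have "u \<in> component V E s"
      using \<open>u \<in> V\<close> by (simp add: component_def)
    then show "u \<in> W"
      using W e(3) component_eq by fastforce
  qed
  have UW: "V = \<Union>?W"
    using component_self by (fastforce simp: component_def)
  have UE: "E = (\<Union>W\<in>?W. ?E W)"
  proof (intro equalityI subsetI)
    fix e assume e: "e \<in> E"
    then obtain s where s: "s \<in> e"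
      using edge(1) by fastforce
    then have "s \<in> V" using edge(2) e by auto
    then have "component V E s \<in> ?W" "s \<in> component V E s"
      using component_self by auto
    then show "e \<in> (\<Union>W\<in>?W. ?E W)"
      using closed e s by blast
  qed auto
  have disjE: "?E A \<inter> ?E B = {}" if "A \<in> ?W" "B \<in> ?W" "A \<noteq> B" for A B
  proof -
    have "e \<noteq> {}" if "e \<in> E" for e
      using edge(1)[OF that] by auto
    then show ?thesis
      using disjoint_components[OF that] by blast
  qed
  have 0: "0 \<notin> \<Union>E"
    using edge(2) assms(2) by blast
  have part: "(\<Prod>c\<in>gnb_clusters (?E W). p c) /
      (\<Prod>S\<in>gnb_separators (gnb_clusters (?E W)). p S ^ (multiplicity_in (gnb_clusters (?E W)) S - 1)) =
      (\<Prod>e\<in>?E W. p (insert 0 e)) / (\<Prod>s\<in>W. p {0, s} ^ (card {e \<in> E. s \<in> e} - 1))"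
    if W: "W \<in> ?W" for W
  proof -
    have "forest W (?E W)"
      using assms(1) by (rule forest_restrict) (use WV[OF W] fin(1) finite_subset in auto)
    moreover have "{e \<in> ?E W. s \<in> e} = {e \<in> E. s \<in> e}" if "s \<in> W" for s
      using closed[OF W] that by blast
    ultimately show ?thesis
      using prod_gnb_separators[of W "?E W" p] prod_gnb_clusters[of "?E W" p] 0 WV[OF W] assms(2)
      by (auto intro!: arg_cong2[where f = "(/)"] prod.cong)
  qed
  have "(\<Prod>(W, E')\<in>tree_components V E.
      (\<Prod>c\<in>gnb_clusters E'. p c) /
      (\<Prod>S\<in>gnb_separators (gnb_clusters E'). p S ^ (multiplicity_in (gnb_clusters E') S - 1))) =
      (\<Prod>W\<in>?W. (\<Prod>e\<in>?E W. p (insert 0 e)) / (\<Prod>s\<in>W. p {0, s} ^ (card {e \<in> E. s \<in> e} - 1)))"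
    by (simp only: T prod.reindex[OF inj] comp_def prod.case) (rule prod.cong[OF refl part])
  also have "\<dots> = (\<Prod>W\<in>?W. \<Prod>e\<in>?E W. p (insert 0 e)) /
      (\<Prod>W\<in>?W. \<Prod>s\<in>W. p {0, s} ^ (card {e \<in> E. s \<in> e} - 1))"
    \<comment> \<open>As division by 0 yields 0, the quotients split even where a marginal
      vanishes.\<close>
    by (rule prod_dividef)
  also have "(\<Prod>W\<in>?W. \<Prod>e\<in>?E W. p (insert 0 e)) = (\<Prod>e\<in>(\<Union>W\<in>?W. ?E W). p (insert 0 e))"
    using fin disjE by (intro prod.UNION_disjoint[symmetric]) auto
  also have "\<dots> = (\<Prod>c\<in>gnb_clusters E. p c)"
    using UE prod_gnb_clusters[OF 0, of p] by simp
  also have "(\<Prod>W\<in>?W. \<Prod>s\<in>W. p {0, s} ^ (card {e \<in> E. s \<in> e} - 1)) =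
      (\<Prod>s\<in>\<Union>?W. p {0, s} ^ (card {e \<in> E. s \<in> e} - 1))"
    using disjoint_components[of _ V E] WV finite_subset[OF _ fin(1)]
    by (subst prod.Union_disjoint) auto
  also have "\<dots> = (\<Prod>s\<in>V. p {0, s} ^ (card {e \<in> E. s \<in> e} - 1))"
    using UW by simp
  finally show "(\<Prod>(W, E')\<in>tree_components V E.
      (\<Prod>c\<in>gnb_clusters E'. p c) /
      (\<Prod>S\<in>gnb_separators (gnb_clusters E'). p S ^ (multiplicity_in (gnb_clusters E') S - 1))) =
    (\<Prod>c\<in>gnb_clusters E. p c) / (\<Prod>s\<in>V. p {0, s} ^ (card {e \<in> E. s \<in> e} - 1))" .
qed

section \<open>The structure learning algorithm\<close>

text \<open>Being a forest is an invariant of the scan: an edge is appended only if it closes no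
  cycle.\<close>

lemma kruskal_scan_forest:
  assumes "forest V (set F)" "set es \<subseteq> complete_edges V"
  shows "forest V (set (kruskal_scan F es))"
  using assms
proof (induction F es rule: kruskal_scan.induct)
  case (2 F e es)
  let ?F = "if \<exists>p. cycle (insert e (set F)) p then F else F @ [e]"
  have "e \<in> complete_edges V"
    using "2.prems"(2) by simp
  then have "forest V (set ?F)"
    using "2.prems"(1) by (auto simp: forest_def simple_graph_def complete_edges_def)
  then show ?case
    using 2 by simp
qed simp

lemma kruskal_forest:
  assumes "kruskal V w F" "finite V"
  shows "forest V (set F)"
proof -
  have "forest V {}"
    using assms(2)
    by (auto simp: forest_def simple_graph_def cycle_def successively_Cons numeral_3_eq_3 Suc_le_length_iff)
  then show ?thesis
    using assms(1) kruskal_scan_forest[of V "[]"] by (auto simp: kruskal_def)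
qed

text \<open>A cluster \<open>insert 0 e\<close> links no two nonzero indices except the ends of
  \<open>e\<close>, so the graph of links among the explanatory indices is \<open>E\<close>
  again.\<close>

lemma gnb_forest_clusters:
  assumes "forest D E" "0 \<notin> D"
  shows "gnb_forest D (\<Union>E) (gnb_clusters E)" and "forest (\<Union>E) E"
proof -
  note edge = forest_edge[OF assms(1)]
  have UD: "\<Union>E \<subseteq> D" using edge(2) by blast
  show f: "forest (\<Union>E) E"
    using finite_subset[OF UD forest_finite(1)[OF assms(1)]] by (intro forest_restrict[OF assms(1)]) auto
  have "{{i, j} | i j. i \<in> \<Union>E \<and> j \<in> \<Union>E \<and> linked (gnb_clusters E) i j} = E"
  proof (intro equalityI subsetI)
    fix e assume "e \<in> E"
    then obtain i j where ij: "e = {i, j}" "i \<noteq> j"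
      using edge(1) unfolding card_2_iff by blast
    have "i \<in> \<Union>E" "j \<in> \<Union>E"
      using \<open>e \<in> E\<close> by (auto intro!: bexI[of _ e] simp: ij(1))
    moreover have "linked (gnb_clusters E) i j"
      unfolding linked_def gnb_clusters_def
      by (intro conjI ij(2) bexI[of _ "insert 0 e"] imageI \<open>e \<in> E\<close>) (simp_all add: ij(1))
    ultimately show "e \<in> {{i, j} | i j. i \<in> \<Union>E \<and> j \<in> \<Union>E \<and> linked (gnb_clusters E) i j}"
      using ij(1) by (intro CollectI exI[of _ i] exI[of _ j] conjI)
  next
    fix e assume "e \<in> {{i, j} | i j. i \<in> \<Union>E \<and> j \<in> \<Union>E \<and> linked (gnb_clusters E) i j}"
    then obtain i j e' where e: "e = {i, j}" "i \<noteq> j" "i \<in> \<Union>E" "j \<in> \<Union>E" "e' \<in> E"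
        "i \<in> insert 0 e'" "j \<in> insert 0 e'"
      unfolding linked_def gnb_clusters_def by blast
    \<comment> \<open>Both indices lie in \<open>D\<close>, hence differ from 0 and come from the
      edge.\<close>
    then have "i \<in> e'" "j \<in> e'"
      using UD assms(2) by blast+
    then have "e = e'"
      using edge(1)[OF e(5)] e(1,2) by (auto simp: card_2_iff)
    with e(5) show "e \<in> E" by (rule back_subst[of "\<lambda>e. e \<in> E", OF _ sym])
  qed
  moreover have "linked (gnb_clusters E) 0 i" if i: "i \<in> \<Union>E" for i
  proof -
    obtain e where "e \<in> E" "i \<in> e" using i by (rule UnionE)
    moreover have "0 \<noteq> i" using i UD assms(2) by (metis subsetD)
    ultimately show ?thesis
      unfolding linked_def gnb_clusters_def by (intro conjI bexI[of _ "insert 0 e"]) simp_all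
  qed
  ultimately show "gnb_forest D (\<Union>E) (gnb_clusters E)"
    using UD assms(2) f unfolding gnb_forest_def by (auto simp: gnb_clusters_def)
qed

text \<open>\<open>structure_density\<close> depends on a junction tree. Existence of one, together
  with the same value for all of them, makes the assigned distribution well defined.\<close>

theorem theorem23:
  fixes M :: "'w measure"
    and X :: "nat \<Rightarrow> 'w \<Rightarrow> real"
    and Y :: "'w \<Rightarrow> 'y"
    and K :: "'y set"
    and f :: "(nat \<Rightarrow> real) \<times> 'y \<Rightarrow> ennreal"
    and d n :: nat
    and D D' :: "nat set"
    and a :: weighting
    and F :: "nat set list"
    and C :: "nat set set"
    and T :: "(nat set \<times> nat set set) set"
  assumes "D = {1..d}"
    and "prob_space M"
    and "countable K"
    and "distributed M (reference_measure D K) (\<lambda>\<omega>. ((\<lambda>i\<in>D. X i \<omega>), Y \<omega>)) f"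
    and "kruskal D (edge_weight a M K X Y) F"
    and "1 \<le> n" and "n \<le> length F"
    and "C = set (take n (map (insert 0) F))"
    and "D' = \<Union>C - {0}"
    and "T = tree_components D' (set (take n F))"
  shows "gnb_forest D D' C \<and>
    (\<exists>J. junction_tree C J) \<and>
    (\<forall>J x. \<forall>y\<in>K. junction_tree C J \<longrightarrow>
      (let p = marginal D K f x y in
        structure_density p C J =
        (\<Prod>(V, E)\<in>T.
            (\<Prod>c\<in>gnb_clusters E. p c) /
            (\<Prod>S\<in>gnb_separators (gnb_clusters E). p S ^ (multiplicity_in (gnb_clusters E) S - 1)))
        * (1 / p {0} ^ (card T - 1))))"
proof -
  let ?E = "set (take n F)"
  have 0: "0 \<notin> D" using assms(1) by simp
  \<comment> \<open>The first \<open>n\<close> selected edges form a subset of the acyclic set of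
    all selected edges.\<close>
  have fD: "forest D ?E"
    using forest_mono[OF kruskal_forest[OF assms(5)] set_take_subset] assms(1) by simp
  have C: "C = gnb_clusters ?E"
    using assms(8) by (simp add: gnb_clusters_def take_map)
  \<comment> \<open>This uses \<open>1 \<le> n\<close>: a junction tree has at least one
    cluster.\<close>
  have "?E \<noteq> {}"
    using assms(6,7) by auto
  have nz: "0 \<notin> \<Union>?E"
    using forest_edge(2)[OF fD] 0 by blast
  have D': "D' = \<Union>?E"
    using assms(9) nz by (auto simp: C gnb_clusters_def)
  note gnb = gnb_forest_clusters[OF fD 0]
  have "\<exists>J. junction_tree C J"
    using forest_junction_tree[OF gnb(2) \<open>?E \<noteq> {}\<close> nz] by (simp add: C gnb_clusters_def)
  \<comment> \<open>Here \<open>p\<close> is arbitrary; the marginal at \<open>x\<close> and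
    \<open>y\<close> is substituted at the end.\<close>
  moreover have "structure_density p C J =
        (\<Prod>(V, E)\<in>T.
            (\<Prod>c\<in>gnb_clusters E. p c) /
            (\<Prod>S\<in>gnb_separators (gnb_clusters E). p S ^ (multiplicity_in (gnb_clusters E) S - 1)))
        * (1 / p {0} ^ (card T - 1))" if "junction_tree C J" for p :: "nat set \<Rightarrow> real" and J
    using gnb_junction_tree_separators[OF gnb(2) nz refl, of J p] that
    unfolding structure_density_def assms(10) D' C tree_components_product[OF gnb(2) nz] by simp
  ultimately show ?thesis
    using gnb(1) by (simp add: C D' Let_def)
qed

end
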